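(* Let $\widetilde{BT}$ be the subgroup of $\mathrm{SL}_2(\mathbb{C})$ described in the context. For every integer $m\ge 0$, let $\lambda_m=(m,m-1,\dots,1)$ be the staircase partition of $\frac{m(m+1)}{2}$. Then the irreducible component of $\mathcal{H}_{m(m+1)/2}^{\widetilde{BT}}$ containing the monomial ideal $I_{\lambda_m}$ has dimension $0$.
   Context: $\widetilde{BT}$ is the subgroup of $\mathrm{SL}_2(\mathbb{C})$ generated by $\omega_4=\mathrm{diag}(\zeta_4,\zeta_4^{-1})$, $s=\begin{pmatrix}0&-1\\1&0\end{pmatrix}$ and $t=\frac{1}{\sqrt2}\begin{pmatrix}\zeta_8&\zeta_8\\ \zeta_8^3&\zeta_8^{-1}\end{pmatrix}$, where $\zeta_k=e^{2i\pi/k}$; it is isomorphic to the binary tetrahedral group (order $24$). $\mathcal{H}_n$ is the Hilbert scheme of $n$ points in $\mathbb{C}^2$ (ideals $I\subset\mathbb{C}[x,y]$ of colength $n$), with the action of $\mathrm{SL}_2(\mathbb{C})$ induced by its linear action on $\mathbb{C}^2$, and $\mathcal{H}_n^{\widetilde{BT}}$ is the fixed-point locus. For a partition $\lambda=(\lambda_1\ge\dots\ge\lambda_r>0)$, $\mathcal{Y}(\lambda)=\{(i,j)\in\mathbb{Z}_{\ge0}^2:j<r,\ i<\lambda_{j+1}\}$ and $I_\lambda$ is the ideal generated by the monomials $x^iy^j$, $(i,j)\notin\mathcal{Y}(\lambda)$; $I_{\lambda_0}=\mathbb{C}[x,y]$. *)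

theory Defs
  imports
    "HOL-Analysis.Analysis"
    "HOL-Algebra.Generated_Groups"
    "HOL-Library.Poly_Mapping"
    "HOL-Library.Extended_Nat"
begin

section \<open>The ring $\mathbb{C}[x,y]$ and its ideals\<close>

text \<open>
  The product of finitely supported functions on the additive monoid of exponents is the
  convolution, so this type is the polynomial ring in two variables.
\<close>

type_synonym poly2 = "nat \<times> nat \<Rightarrow>\<^sub>0 complex"

definition mono2 :: "nat \<times> nat \<Rightarrow> poly2" where
  "mono2 e = Poly_Mapping.single e 1"

definition const2 :: "complex \<Rightarrow> poly2" where
  "const2 c = Poly_Mapping.single (0, 0) c"

text \<open>An ideal is a submodule of the ring, regarded as a module over itself.\<close>

lemma module_mult: "module ((*) :: 'a::comm_ring_1 \<Rightarrow> 'a \<Rightarrow> 'a)"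
  by unfold_locales (simp_all add: algebra_simps)

abbreviation is_ideal :: "'a::comm_ring_1 set \<Rightarrow> bool" where
  "is_ideal \<equiv> module.subspace (*)"

abbreviation ideal_generated_by :: "'a::comm_ring_1 set \<Rightarrow> 'a set" where
  "ideal_generated_by \<equiv> module.span (*)"

text \<open>
  \<open>basis_mod I B\<close>: the residue classes of the elements of \<open>B\<close> are pairwise distinct and form a
  finite basis of the complex vector space $\mathbb{C}[x,y]/I$.  The coefficient functions are
  normalised to vanish off \<open>B\<close>, so that uniqueness is meaningful.
\<close>

definition basis_mod :: "poly2 set \<Rightarrow> poly2 set \<Rightarrow> bool" where
  "basis_mod I B \<longleftrightarrow> finite B \<and>
     (\<forall>f. \<exists>!c :: poly2 \<Rightarrow> complex. (\<forall>b. b \<notin> B \<longrightarrow> c b = 0) \<and> f - (\<Sum>b\<in>B. const2 (c b) * b) \<in> I)"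

definition coeff_mod :: "poly2 set \<Rightarrow> poly2 set \<Rightarrow> poly2 \<Rightarrow> poly2 \<Rightarrow> complex" where
  "coeff_mod I B f =
     (THE c. (\<forall>b. b \<notin> B \<longrightarrow> c b = 0) \<and> f - (\<Sum>b\<in>B. const2 (c b) * b) \<in> I)"

definition has_colength :: "poly2 set \<Rightarrow> nat \<Rightarrow> bool" where
  "has_colength I n \<longleftrightarrow> (\<exists>B. basis_mod I B \<and> card B = n)"


section \<open>Closed points of the Hilbert scheme and their Zariski topology\<close>

definition hilb :: "nat \<Rightarrow> poly2 set set" where
  "hilb n = {I. is_ideal I \<and> has_colength I n}"

text \<open>
  For a set \<open>M\<close> of monomials the ideals \<open>I\<close> such that \<open>M\<close> is a basis modulo \<open>I\<close> form an open
  affine subscheme of the Hilbert scheme (nonempty only for \<open>n\<close>-element \<open>M\<close>), and these cover it.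
\<close>

definition hilb_chart :: "nat \<Rightarrow> poly2 set \<Rightarrow> poly2 set set" where
  "hilb_chart n M = {I \<in> hilb n. basis_mod I M}"

text \<open>
  The coordinate ring of the chart of \<open>M\<close> is the complex algebra generated by the functions
  sending \<open>I\<close> to the coefficient of \<open>b \<in> M\<close> in the expansion modulo \<open>I\<close> of the monomial with
  exponent \<open>e\<close>.
\<close>

inductive_set chart_functions :: "poly2 set \<Rightarrow> (poly2 set \<Rightarrow> complex) set"
  for M :: "poly2 set" where
  const: "(\<lambda>_. c) \<in> chart_functions M"
| coord: "b \<in> M \<Longrightarrow> (\<lambda>I. coeff_mod I M (mono2 e) b) \<in> chart_functions M"
| add: "\<phi> \<in> chart_functions M \<Longrightarrow> \<psi> \<in> chart_functions M \<Longrightarrow> (\<lambda>I. \<phi> I + \<psi> I) \<in> chart_functions M"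
| mult: "\<phi> \<in> chart_functions M \<Longrightarrow> \<psi> \<in> chart_functions M \<Longrightarrow> (\<lambda>I. \<phi> I * \<psi> I) \<in> chart_functions M"

text \<open>
  The principal open subsets of the charts form a base of the Zariski topology on the closed
  points of the Hilbert scheme.
\<close>

definition hilb_zariski :: "nat \<Rightarrow> poly2 set topology" where
  "hilb_zariski n = topology_generated_by
     {{I \<in> hilb_chart n M. \<phi> I \<noteq> 0} | M \<phi>. M \<subseteq> range mono2 \<and> \<phi> \<in> chart_functions M}"


section \<open>The action of $\mathrm{SL}_2(\mathbb{C})$ and fixed points\<close>

definition SL2 :: "(complex^2^2) monoid" where
  "SL2 = \<lparr>carrier = {A. det A = 1}, mult = (**), one = mat 1\<rparr>"

lemma group_SL2: "group SL2"
proof (rule groupI)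
  fix A assume "A \<in> carrier SL2"
  then have A: "det A = 1" by (simp add: SL2_def)
  then obtain B where B: "B ** A = mat 1"
    by (metis invertible_det_nz invertible_left_inverse zero_neq_one)
  then have "det B * det A = 1" by (metis det_I det_mul)
  with A B show "\<exists>B\<in>carrier SL2. B \<otimes>\<^bsub>SL2\<^esub> A = \<one>\<^bsub>SL2\<^esub>"
    by (intro bexI[of _ B]) (auto simp: SL2_def)
qed (auto simp: SL2_def det_mul matrix_mul_assoc)

text \<open>\<open>subst_lin A f\<close> is $f\circ A$, i.e. $f(ax+by, cx+dy)$ for \<open>A\<close> with rows $(a,b)$, $(c,d)$.\<close>

definition subst_lin :: "complex^2^2 \<Rightarrow> poly2 \<Rightarrow> poly2" where
  "subst_lin A f = (\<Sum>(i, j) \<in> Poly_Mapping.keys f.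
     const2 (Poly_Mapping.lookup f (i, j))
       * (const2 (A$1$1) * mono2 (1, 0) + const2 (A$1$2) * mono2 (0, 1)) ^ i
       * (const2 (A$2$1) * mono2 (1, 0) + const2 (A$2$2) * mono2 (0, 1)) ^ j)"

text \<open>
  If \<open>I\<close> is the ideal of a subscheme $Z$ of the plane, then \<open>ideal_act A I\<close> is the ideal of the
  image $AZ$.
\<close>

definition ideal_act :: "complex^2^2 \<Rightarrow> poly2 set \<Rightarrow> poly2 set" where
  "ideal_act A I = {f. subst_lin A f \<in> I}"

definition hilb_fixed :: "nat \<Rightarrow> (complex^2^2) set \<Rightarrow> poly2 set topology" where
  "hilb_fixed n G = subtopology (hilb_zariski n) {I \<in> hilb n. \<forall>A\<in>G. ideal_act A I = I}"


section \<open>The binary tetrahedral group\<close>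

definition zeta :: "nat \<Rightarrow> complex" where
  "zeta k = exp (2 * \<i> * of_real pi / of_nat k)"

definition mat2 :: "complex \<Rightarrow> complex \<Rightarrow> complex \<Rightarrow> complex \<Rightarrow> complex^2^2" where
  "mat2 a b c d = vector [vector [a, b], vector [c, d]]"

definition BT_omega :: "complex^2^2" where
  "BT_omega = mat2 (zeta 4) 0 0 (inverse (zeta 4))"

definition BT_s :: "complex^2^2" where
  "BT_s = mat2 0 (-1) 1 0"

definition BT_t :: "complex^2^2" where
  "BT_t = mat2 (zeta 8 / of_real (sqrt 2)) (zeta 8 / of_real (sqrt 2))
               (zeta 8 ^ 3 / of_real (sqrt 2)) (inverse (zeta 8) / of_real (sqrt 2))"

definition BT :: "(complex^2^2) set" where
  "BT = generate SL2 {BT_omega, BT_s, BT_t}"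

lemma det_mat2: "det (mat2 a b c d) = a * d - b * c"
  by (simp add: mat2_def det_2)

lemma BT_generators_SL2: "{BT_omega, BT_s, BT_t} \<subseteq> carrier SL2"
proof -
  have nz: "zeta k \<noteq> 0" for k by (simp add: zeta_def)
  have "zeta 8 ^ 4 = exp (of_nat 4 * (2 * \<i> * of_real pi / of_nat 8))"
    unfolding zeta_def by (rule exp_of_nat_mult[symmetric])
  also have "of_nat 4 * (2 * \<i> * of_real pi / of_nat 8) = \<i> * of_real pi"
    by simp
  finally have z8: "zeta 8 ^ 4 = -1" by simp
  have "zeta 8 * zeta 8 ^ 3 = -1"
    using z8 by (simp add: eval_nat_numeral)
  moreover have "complex_of_real (sqrt 2) * complex_of_real (sqrt 2) = 2"
    by (simp flip: of_real_mult)
  ultimately have "det BT_t = 1"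
    using nz[of 8] by (simp add: BT_t_def det_mat2)
  then show ?thesis
    using nz[of 4] by (simp add: SL2_def BT_omega_def BT_s_def det_mat2)
qed


section \<open>Monomial ideals of partitions\<close>

definition young_diagram :: "nat list \<Rightarrow> (nat \<times> nat) set" where
  "young_diagram l = {(i, j). j < length l \<and> i < l ! j}"

definition partition_ideal :: "nat list \<Rightarrow> poly2 set" where
  "partition_ideal l = ideal_generated_by {mono2 e | e. e \<notin> young_diagram l}"

text \<open>The list \<open>[m, m - 1, \<dots>, 1]\<close>.\<close>

definition staircase :: "nat \<Rightarrow> nat list" where
  "staircase m = rev [1..<Suc m]"


section \<open>Irreducible components and Krull dimension of a topological space\<close>

definition irreduciblein :: "'a topology \<Rightarrow> 'a set \<Rightarrow> bool" where
  "irreduciblein X S \<longleftrightarrow> S \<subseteq> topspace X \<and> S \<noteq> {} \<and>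
     (\<forall>A B. closedin X A \<longrightarrow> closedin X B \<longrightarrow> S \<subseteq> A \<union> B \<longrightarrow> S \<subseteq> A \<or> S \<subseteq> B)"

definition irreducible_component :: "'a topology \<Rightarrow> 'a set \<Rightarrow> bool" where
  "irreducible_component X C \<longleftrightarrow> irreduciblein X C \<and>
     (\<forall>D. irreduciblein X D \<longrightarrow> C \<subseteq> D \<longrightarrow> D = C)"

text \<open>
  The supremum of the lengths \<open>n\<close> of chains $Z_0\subset\dots\subset Z_n$ of irreducible closed
  subsets.  The empty space gets the value 0 here.
\<close>

definition krull_dim :: "'a topology \<Rightarrow> enat" where
  "krull_dim X = Sup {enat n | n. \<exists>Z :: nat \<Rightarrow> 'a set.
     (\<forall>i\<le>n. closedin X (Z i) \<and> irreduciblein X (Z i)) \<and> (\<forall>i<n. Z i \<subset> Z (Suc i))}"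

end

theory Submission
  imports Defs
begin

text \<open>
  The ideal of the staircase is $(x,y)^m$, and the binary tetrahedral group enters only through its
  central element $-1$.  The ideals for which the monomials of degree $< m$ form a basis of the
  quotient are an open neighbourhood of $(x,y)^m$.  If such an ideal $J$ is invariant under $-1$,
  each monomial of degree $m$ is congruent modulo $J$ to a polynomial of degree at most $m - 2$,
  and the linear syzygies between these monomials force this polynomial to be $0$.
  Hence $J = (x,y)^m$, so $(x,y)^m$ is an isolated closed point of the fixed locus.
\<close>

section \<open>Polynomials as sums of monomials\<close>

lemma poly2_eq_sum: "f = (\<Sum>e\<in>Poly_Mapping.keys f. Poly_Mapping.single e (Poly_Mapping.lookup f e))"
  by (rule poly_mapping_eqI)
    (auto simp: lookup_sum lookup_single when_def in_keys_iff sum.delta)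

lemma single_eq_const2_mult: "Poly_Mapping.single e c = const2 c * mono2 e"
  by (simp add: const2_def mono2_def mult_single zero_prod_def[symmetric])

text \<open>A polynomial is the finite sum of its terms, so a property that is additive in the
  polynomial need only be checked on single terms.\<close>

lemma poly2_induct [case_names zero single add]:
  fixes f :: poly2
  assumes "P 0" "\<And>e c. P (Poly_Mapping.single e c)" "\<And>f g. P f \<Longrightarrow> P g \<Longrightarrow> P (f + g)"
  shows "P f"
proof -
  have "P (\<Sum>e\<in>S. Poly_Mapping.single e (Poly_Mapping.lookup f e))" if "finite S" for S
    using that by (induction S) (auto intro: assms)
  then show ?thesis
    by (subst poly2_eq_sum) simp
qed

lemma inj_mono2: "inj mono2"
proof (rule injI)
  fix e k assume "mono2 e = mono2 k"
  then have "Poly_Mapping.lookup (mono2 e) k = Poly_Mapping.lookup (mono2 k) k" by simp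
  then show "e = k" by (simp add: mono2_def lookup_single when_def split: if_splits)
qed

lemma lookup_single_times:
  "Poly_Mapping.lookup (Poly_Mapping.single k c * f) (k + e) = c * Poly_Mapping.lookup f e"
  for f :: poly2
  by (induction f rule: poly2_induct)
    (simp_all add: mult_single lookup_single when_def lookup_add distrib_left)

lemma lookup_const2_times: "Poly_Mapping.lookup (const2 c * f) e = c * Poly_Mapping.lookup f e"
  using lookup_single_times[of 0 c f e] by (simp only: const2_def zero_prod_def[symmetric] add_0)

lemma lookup_single_times_eq_0:
  "(\<And>l. e \<noteq> k + l) \<Longrightarrow> Poly_Mapping.lookup (Poly_Mapping.single k c * f) e = 0"
  for f :: poly2
  by (induction f rule: poly2_induct)
    (auto simp: mult_single lookup_single when_def lookup_add distrib_left)

lemma const2_add: "const2 (a + b) = const2 a + const2 b"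
  and const2_mult: "const2 (a * b) = const2 a * const2 b"
  and const2_0: "const2 0 = 0"
  and const2_1: "const2 1 = 1"
  by (simp_all add: const2_def single_add mult_single flip: zero_prod_def)


section \<open>Linear substitutions\<close>

definition lin_form :: "complex^2 \<Rightarrow> poly2" where
  "lin_form v = const2 (v$1) * mono2 (1, 0) + const2 (v$2) * mono2 (0, 1)"

lemma subst_lin_alt:
  "subst_lin A f = (\<Sum>e\<in>Poly_Mapping.keys f.
     const2 (Poly_Mapping.lookup f e) * lin_form (A$1) ^ fst e * lin_form (A$2) ^ snd e)"
  by (simp add: subst_lin_def lin_form_def split_def)

lemma subst_lin_zero: "subst_lin A 0 = 0"
  by (simp add: subst_lin_alt)

lemma subst_lin_add: "subst_lin A (f + g) = subst_lin A f + subst_lin A g"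
  \<comment> \<open>The supports of \<open>f\<close>, \<open>g\<close> and \<open>f + g\<close> may
    differ; this is harmless because the summand is additive in the coefficient and vanishes at
    coefficient 0.\<close>
  unfolding subst_lin_alt
  by (rule setsum_keys_plus_distrib) (simp_all add: const2_0 const2_add algebra_simps)

lemma subst_lin_sum: "subst_lin A (sum f S) = (\<Sum>x\<in>S. subst_lin A (f x))"
  by (induction S rule: infinite_finite_induct) (simp_all add: subst_lin_zero subst_lin_add)

lemma subst_lin_single:
  "subst_lin A (Poly_Mapping.single e c) = const2 c * lin_form (A$1) ^ fst e * lin_form (A$2) ^ snd e"
  by (cases "c = 0") (simp_all add: subst_lin_alt const2_0)

lemma subst_lin_const2: "subst_lin A (const2 c) = const2 c"
  using subst_lin_single[of A "(0, 0)" c] by (simp add: const2_def)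

lemma subst_lin_mult: "subst_lin A (f * g) = subst_lin A f * subst_lin A g"
proof (induction f rule: poly2_induct)
  case (single e c)
  show ?case
    by (induction g rule: poly2_induct)
      (simp_all add: subst_lin_zero subst_lin_add subst_lin_single mult_single const2_mult
        power_add algebra_simps)
qed (simp_all add: subst_lin_zero subst_lin_add algebra_simps)

lemma subst_lin_power: "subst_lin A (f ^ n) = subst_lin A f ^ n"
  using subst_lin_const2[of A 1] by (induction n) (simp_all add: subst_lin_mult const2_1)

lemma subst_lin_lin_form: "subst_lin B (lin_form (A$i)) = lin_form ((A ** B)$i)"
proof -
  have "subst_lin B (mono2 (1, 0)) = lin_form (B$1)" "subst_lin B (mono2 (0, 1)) = lin_form (B$2)"
    by (simp_all add: mono2_def subst_lin_single const2_1)
  then have "subst_lin B (lin_form (A$i))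
      = const2 (A$i$1) * lin_form (B$1) + const2 (A$i$2) * lin_form (B$2)"
    by (simp add: lin_form_def[of "A$i"] subst_lin_add subst_lin_mult subst_lin_const2)
  also have "\<dots> = lin_form ((A ** B)$i)"
    by (simp add: lin_form_def matrix_matrix_mult_def sum_2 const2_add const2_mult algebra_simps)
  finally show ?thesis .
qed

text \<open>Substitution is a ring homomorphism fixing the constants, so it suffices to follow the
  linear forms given by the rows. The order is that of (f o A) o B = f o (AB).\<close>

lemma subst_lin_compose: "subst_lin B (subst_lin A f) = subst_lin (A ** B) f"
  by (simp add: subst_lin_alt[of A] subst_lin_alt[of "A ** B"] subst_lin_sum subst_lin_mult
      subst_lin_const2 subst_lin_power subst_lin_lin_form)

lemma subst_lin_mat_1: "subst_lin (mat 1) f = f"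
proof -
  have "lin_form (mat 1 $ 1) = mono2 (1, 0)" "lin_form (mat 1 $ 2) = mono2 (0, 1)"
    by (simp_all add: lin_form_def mat_def const2_0 const2_1)
  moreover have "mono2 (1, 0) ^ i = mono2 (i, 0)" "mono2 (0, 1) ^ i = mono2 (0, i)" for i
    by (induction i) (simp_all add: mono2_def mult_single flip: zero_prod_def)
  ultimately have "subst_lin (mat 1) (Poly_Mapping.single e c) = Poly_Mapping.single e c" for e c
    by (cases e) (simp add: subst_lin_single mult.assoc,
        simp add: mono2_def const2_def mult_single flip: zero_prod_def)
  then show ?thesis
    by (induction f rule: poly2_induct) (simp_all add: subst_lin_zero subst_lin_add)
qed

text \<open>Both variables change sign, so a term of degree d acquires d signs. Invariance under -1
  thus becomes a parity condition on degrees.\<close>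

lemma lookup_subst_lin_uminus:
  "Poly_Mapping.lookup (subst_lin (- mat 1) f) e = (-1) ^ (fst e + snd e) * Poly_Mapping.lookup f e"
proof (induction f rule: poly2_induct)
  case (single k c)
  have "lin_form ((- mat 1) $ i) = - lin_form (mat 1 $ i)" for i
    by (simp add: lin_form_def const2_def single_uminus)
  then have "subst_lin (- mat 1) (Poly_Mapping.single k c)
      = (-1) ^ (fst k + snd k) * subst_lin (mat 1) (Poly_Mapping.single k c)"
    by (simp add: subst_lin_single power_minus[of "lin_form _"] power_add)
  also have "\<dots> = Poly_Mapping.single k ((-1) ^ (fst k + snd k) * c)"
    by (cases "even (fst k + snd k)") (simp_all add: subst_lin_mat_1 single_uminus)
  finally show ?case by (auto simp: lookup_single when_def)
qed (simp_all add: subst_lin_zero subst_lin_add lookup_add algebra_simps)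


section \<open>Powers of the maximal ideal at the origin\<close>

definition monomials_below :: "nat \<Rightarrow> (nat \<times> nat) set" where
  "monomials_below m = {e. fst e + snd e < m}"

text \<open>This is the ideal (x,y)^m, encoded through supports so that membership can be tested
  coefficient by coefficient.\<close>

definition order_ge :: "nat \<Rightarrow> poly2 set" where
  "order_ge m = {f. \<forall>e\<in>Poly_Mapping.keys f. m \<le> fst e + snd e}"

lemma order_ge_iff: "f \<in> order_ge m \<longleftrightarrow> (\<forall>e\<in>monomials_below m. Poly_Mapping.lookup f e = 0)"
  by (simp add: order_ge_def monomials_below_def Ball_def in_keys_iff del: split_paired_All)
    (metis not_le)

lemma order_ge_0: "order_ge 0 = UNIV"
  by (simp add: order_ge_def)

lemma order_ge_add: "f \<in> order_ge m \<Longrightarrow> g \<in> order_ge m \<Longrightarrow> f + g \<in> order_ge m"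
  by (simp add: order_ge_iff lookup_add)

lemma order_ge_sum: "(\<And>x. x \<in> S \<Longrightarrow> f x \<in> order_ge m) \<Longrightarrow> sum f S \<in> order_ge m"
  by (simp add: order_ge_iff lookup_sum)

lemma order_ge_mult: "f \<in> order_ge m \<Longrightarrow> g \<in> order_ge n \<Longrightarrow> f * g \<in> order_ge (m + n)"
  using keys_mult[of f g] by (fastforce simp: order_ge_def)

lemma order_ge_power: "f \<in> order_ge m \<Longrightarrow> f ^ i \<in> order_ge (i * m)"
  by (induction i) (simp_all add: order_ge_0 order_ge_mult)

lemma order_ge_mono: "m \<le> n \<Longrightarrow> order_ge n \<subseteq> order_ge m"
  by (auto simp: order_ge_def)

lemma is_ideal_order_ge: "is_ideal (order_ge m)"
proof (rule module.subspaceI[OF module_mult])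
  show "f * g \<in> order_ge m" if "g \<in> order_ge m" for f g
    using order_ge_mult[OF _ that, of f 0] by (simp add: order_ge_0)
qed (simp_all add: order_ge_add, simp add: order_ge_def)

lemma order_ge_eq_generated:
  "order_ge m = ideal_generated_by {mono2 e | e. e \<notin> monomials_below m}"
proof
  show "order_ge m \<subseteq> ideal_generated_by {mono2 e | e. e \<notin> monomials_below m}"
  proof
    fix f assume f: "f \<in> order_ge m"
    have "(\<Sum>e\<in>Poly_Mapping.keys f. const2 (Poly_Mapping.lookup f e) * mono2 e)
        \<in> ideal_generated_by {mono2 e | e. e \<notin> monomials_below m}"
      using f
      by (intro module.span_sum[OF module_mult] module.span_scale[OF module_mult]
          subsetD[OF module.span_superset[OF module_mult]])
        (force simp: order_ge_def monomials_below_def)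
    then show "f \<in> ideal_generated_by {mono2 e | e. e \<notin> monomials_below m}"
      unfolding single_eq_const2_mult[symmetric] poly2_eq_sum[symmetric] .
  qed
  show "ideal_generated_by {mono2 e | e. e \<notin> monomials_below m} \<subseteq> order_ge m"
    by (rule module.span_minimal[OF module_mult _ is_ideal_order_ge])
      (auto simp: order_ge_def mono2_def monomials_below_def)
qed

text \<open>Row j of the staircase has length m - j, and i < m - j amounts to i + j < m.\<close>

lemma young_diagram_staircase: "young_diagram (staircase m) = monomials_below m"
  by (auto simp: young_diagram_def staircase_def monomials_below_def rev_nth
      simp del: upt_Suc)

lemma partition_ideal_staircase: "partition_ideal (staircase m) = order_ge m"
  by (simp add: partition_ideal_def young_diagram_staircase order_ge_eq_generated)

section \<open>Invariance of (x,y)^m under linear substitutions\<close>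

lemma lin_form_order_ge: "lin_form v \<in> order_ge 1"
  by (auto simp: order_ge_iff lin_form_def lookup_add monomials_below_def const2_def mono2_def
      mult_single lookup_single)

lemma subst_lin_order_ge:
  assumes "f \<in> order_ge m"
  shows "subst_lin A f \<in> order_ge m"
  unfolding subst_lin_alt
proof (rule order_ge_sum)
  fix e assume "e \<in> Poly_Mapping.keys f"
  with assms have "m \<le> fst e + snd e" by (auto simp: order_ge_def)
  moreover have "const2 (Poly_Mapping.lookup f e) * lin_form (A$1) ^ fst e * lin_form (A$2) ^ snd e
      \<in> order_ge (0 + fst e * 1 + snd e * 1)"
    by (intro order_ge_mult order_ge_power lin_form_order_ge) (simp add: order_ge_0)
  ultimately show "const2 (Poly_Mapping.lookup f e) * lin_form (A$1) ^ fst e * lin_form (A$2) ^ snd e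
      \<in> order_ge m"
    using order_ge_mono[of m "fst e + snd e"] by auto
qed

text \<open>A linear substitution never lowers the order of vanishing at the origin; applying this
  to the inverse matrix as well gives equality.\<close>

lemma ideal_act_order_ge:
  assumes "det A \<noteq> 0"
  shows "ideal_act A (order_ge m) = order_ge m"
proof -
  obtain B where B: "A ** B = mat 1"
    using assms by (metis invertible_det_nz invertible_right_inverse)
  have "f \<in> order_ge m" if "subst_lin A f \<in> order_ge m" for f
    using subst_lin_order_ge[OF that, of B] by (simp add: subst_lin_compose B subst_lin_mat_1)
  then show ?thesis
    by (auto simp: ideal_act_def intro: subst_lin_order_ge)
qed

section \<open>The monomial basis of the quotient by (x,y)^m\<close>

lemma finite_card_monomials_below:
  "finite (monomials_below m) \<and> card (monomials_below m) = m * (m + 1) div 2"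
proof (induction m)
  case 0
  then show ?case by (simp add: monomials_below_def)
next
  case (Suc m)
  \<comment> \<open>The new exponents form the antidiagonal of degree m, which has m + 1
    points.\<close>
  have eq: "monomials_below (Suc m) = monomials_below m \<union> (\<lambda>i. (i, m - i)) ` {..m}"
    by (auto simp: monomials_below_def image_iff)
  have "monomials_below m \<inter> (\<lambda>i. (i, m - i)) ` {..m} = {}"
    by (auto simp: monomials_below_def)
  moreover have "card ((\<lambda>i. (i, m - i)) ` {..m}) = m + 1"
    by (subst card_image) (auto simp: inj_on_def)
  ultimately show ?case
    using Suc by (simp add: eq card_Un_disjoint)
qed

lemmas finite_monomials_below = conjunct1[OF finite_card_monomials_below]
  and card_monomials_below = conjunct2[OF finite_card_monomials_below]

lemma lookup_sum_monomials_below: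
  "Poly_Mapping.lookup (\<Sum>b\<in>mono2 ` monomials_below m. const2 (c b) * b) e =
     (if e \<in> monomials_below m then c (mono2 e) else 0)"
  by (subst sum.reindex)
    (auto simp: inj_on_subset[OF inj_mono2] lookup_sum lookup_single when_def
      finite_monomials_below simp flip: single_eq_const2_mult)

text \<open>Congruence modulo (x,y)^m means equality of all coefficients in degree below m, so the
  truncation of f is its only possible expansion.\<close>

lemma basis_mod_order_ge: "basis_mod (order_ge m) (mono2 ` monomials_below m)"
  unfolding basis_mod_def
proof (intro conjI allI)
  fix f :: poly2
  \<comment> \<open>Coefficients are indexed by monomials, not exponents, so the exponent is
    recovered through the inverse of \<open>mono2\<close>.\<close>
  define c where "c b = (if b \<in> mono2 ` monomials_below m
    then Poly_Mapping.lookup f (inv_into UNIV mono2 b) else 0)" for b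
  show "\<exists>!c. (\<forall>b. b \<notin> mono2 ` monomials_below m \<longrightarrow> c b = 0) \<and>
      f - (\<Sum>b\<in>mono2 ` monomials_below m. const2 (c b) * b) \<in> order_ge m"
    by (rule ex1I[of _ c])
      (auto simp: order_ge_iff lookup_minus lookup_sum_monomials_below c_def inv_f_f[OF inj_mono2]
        fun_eq_iff)
qed (simp add: finite_monomials_below)

lemma order_ge_in_hilb: "order_ge m \<in> hilb (m * (m + 1) div 2)"
  using basis_mod_order_ge[of m]
  by (auto simp: hilb_def has_colength_def is_ideal_order_ge card_image inj_on_subset[OF inj_mono2]
      card_monomials_below)


section \<open>Bases modulo an ideal\<close>

lemma basis_mod_coeff_mod:
  assumes "basis_mod I B"
  shows "b \<notin> B \<Longrightarrow> coeff_mod I B f b = 0"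
    and "f - (\<Sum>b\<in>B. const2 (coeff_mod I B f b) * b) \<in> I"
proof -
  have "\<exists>!c. (\<forall>b. b \<notin> B \<longrightarrow> c b = 0) \<and> f - (\<Sum>b\<in>B. const2 (c b) * b) \<in> I"
    using assms by (simp add: basis_mod_def)
  from theI'[OF this]
  show "b \<notin> B \<Longrightarrow> coeff_mod I B f b = 0"
    and "f - (\<Sum>b\<in>B. const2 (coeff_mod I B f b) * b) \<in> I"
    unfolding coeff_mod_def[symmetric] by auto
qed

lemma basis_mod_eq:
  assumes "basis_mod I B" "\<And>b. b \<notin> B \<Longrightarrow> c b = 0" "f - (\<Sum>b\<in>B. const2 (c b) * b) \<in> I"
  shows "coeff_mod I B f = c"
  using assms basis_mod_coeff_mod[OF assms(1), where f = f] unfolding basis_mod_def by blast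

text \<open>An expansion modulo I is also one modulo J, so the two coefficient functions agree; for
  f in J they vanish, which puts f into I. This replaces a comparison of the dimensions of the
  quotients.\<close>

lemma ideal_eqI:
  assumes I: "basis_mod I B" and J: "basis_mod J B" "is_ideal J" and "I \<subseteq> J"
  shows "I = J"
proof
  show "J \<subseteq> I"
  proof
    fix f assume f: "f \<in> J"
    have "coeff_mod I B f = coeff_mod J B f"
      using basis_mod_coeff_mod[OF I] \<open>I \<subseteq> J\<close> by (intro basis_mod_eq[OF J(1), symmetric]) auto
    also have "\<dots> = (\<lambda>_. 0)"
      using f by (intro basis_mod_eq[OF J(1)]) (simp_all add: const2_0)
    finally show "f \<in> I"
      using basis_mod_coeff_mod(2)[OF I, of f] by (simp add: const2_0)
  qed
qed fact


section \<open>Ideals invariant under the antipode\<close>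

context
  fixes m :: nat and J :: "poly2 set"
  assumes ideal: "is_ideal J"
    and basis: "basis_mod J (mono2 ` monomials_below m)"
begin

text \<open>Such an f has two expansions modulo J, one with its own coefficients and one with all
  coefficients 0; uniqueness identifies them.\<close>

lemma low_degree_in_ideal_eq_0:
  assumes "f \<in> J" "Poly_Mapping.keys f \<subseteq> monomials_below m"
  shows "f = 0"
proof -
  let ?B = "mono2 ` monomials_below m"
  define c where "c b = (if b \<in> ?B then Poly_Mapping.lookup f (inv_into UNIV mono2 b) else 0)" for b
  have f: "f = (\<Sum>b\<in>?B. const2 (c b) * b)"
    using assms(2) by (intro poly_mapping_eqI)
      (auto simp: lookup_sum_monomials_below c_def inv_f_f[OF inj_mono2] in_keys_iff)
  have "coeff_mod J ?B f = c"
  proof (rule basis_mod_eq[OF basis])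
    show "f - (\<Sum>b\<in>?B. const2 (c b) * b) \<in> J"
      unfolding f[symmetric] by (simp add: module.subspace_0[OF module_mult ideal])
  qed (simp add: c_def)
  moreover have "coeff_mod J ?B f = (\<lambda>_. 0)"
    by (rule basis_mod_eq[OF basis]) (simp_all add: const2_0 assms)
  ultimately have "c = (\<lambda>_. 0)" by simp
  then show ?thesis by (subst f) (simp add: const2_0)
qed

lemma reduce_mod_ideal:
  obtains p where "Poly_Mapping.keys p \<subseteq> monomials_below m" "f - p \<in> J"
  using basis_mod_coeff_mod(2)[OF basis, of f]
  by (intro that[of "\<Sum>b\<in>mono2 ` monomials_below m.
        const2 (coeff_mod J (mono2 ` monomials_below m) f b) * b"])
    (auto simp: in_keys_iff lookup_sum_monomials_below split: if_splits)

text \<open>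
  The remainder \<open>p\<close> of a monomial of degree \<open>m\<close> has the parity of \<open>m\<close>, so its degree
  is at most \<open>m - 2\<close>.
\<close>

lemma remainder_parity:
  assumes inv: "ideal_act (- mat 1) J = J"
    and e: "fst e + snd e = m"
    and p: "Poly_Mapping.keys p \<subseteq> monomials_below m" "mono2 e - p \<in> J"
    and k: "k \<in> Poly_Mapping.keys p"
  shows "Suc (fst k + snd k) < m"
proof -
  let ?s = "subst_lin (- mat 1)"
  \<comment> \<open>The monomial of degree m is an eigenvector of -1 with eigenvalue (-1)^m, so it
    cancels in q. What survives are the terms of p of the wrong parity, all of degree below
    m.\<close>
  define q where "q = ?s (mono2 e - p) - const2 ((-1) ^ m) * (mono2 e - p)"
  have "q \<in> J"
    using p(2) inv unfolding q_def ideal_act_def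
    by (blast intro: module.subspace_diff[OF module_mult ideal] module.subspace_scale[OF module_mult ideal])
  have q: "Poly_Mapping.lookup q k =
      ((-1) ^ m - (-1) ^ (fst k + snd k)) * Poly_Mapping.lookup p k" for k
    using e unfolding q_def lookup_minus lookup_subst_lin_uminus lookup_const2_times
    by (auto simp: mono2_def lookup_single when_def algebra_simps)
  have "q = 0"
    using \<open>q \<in> J\<close> p(1)
    by (intro low_degree_in_ideal_eq_0) (auto simp: in_keys_iff q)
  then have "(-1) ^ m = (-1 :: complex) ^ (fst k + snd k)"
    using k q[of k] by (auto simp: in_keys_iff)
  \<comment> \<open>Equal parity rules out degree m - 1.\<close>
  then have "even m \<longleftrightarrow> even (fst k + snd k)"
    by (auto simp: minus_one_power_iff split: if_splits)
  moreover have "fst k + snd k < m"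
    using k p(1) by (auto simp: monomials_below_def)
  ultimately show ?thesis
    by (metis Suc_lessI even_Suc)
qed

text \<open>
  Reducing the syzygies $y \cdot x^{i+1}y^j = x \cdot x^iy^{j+1}$ forces the remainder of $x^iy^j$
  to be divisible by $x^i$ and by $y^j$, hence to vanish for degree reasons.
\<close>

lemma antipode_invariant_ideal_eq:
  assumes inv: "ideal_act (- mat 1) J = J"
  shows "J = order_ge m"
proof -
  define p where "p e = (SOME p. Poly_Mapping.keys p \<subseteq> monomials_below m \<and> mono2 e - p \<in> J)" for e
  have p: "Poly_Mapping.keys (p e) \<subseteq> monomials_below m" "mono2 e - p e \<in> J" for e
    using someI_ex[of "\<lambda>p. Poly_Mapping.keys p \<subseteq> monomials_below m \<and> mono2 e - p \<in> J"]
      reduce_mod_ideal[of "mono2 e"] unfolding p_def by blast+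
  have p_small: "Suc (a + b) < m"
    if "Poly_Mapping.lookup (p (i, j)) (a, b) \<noteq> 0" "i + j = m" for i j a b
    using remainder_parity[OF inv _ p, of "(i, j)" "(a, b)"] that by (simp add: in_keys_iff)
  let ?x = "mono2 (Suc 0, 0)" and ?y = "mono2 (0, Suc 0)"
  have lx: "Poly_Mapping.lookup (?x * f) (Suc a, b) = Poly_Mapping.lookup f (a, b)"
    and lx0: "Poly_Mapping.lookup (?x * f) (0, b) = 0"
    and ly: "Poly_Mapping.lookup (?y * f) (a, Suc b) = Poly_Mapping.lookup f (a, b)"
    and ly0: "Poly_Mapping.lookup (?y * f) (a, 0) = 0" for f a b
    using lookup_single_times[of "(1, 0)" 1 f "(a, b)"] lookup_single_times[of "(0, 1)" 1 f "(a, b)"]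
      lookup_single_times_eq_0[of "(0, b)" "(1, 0)" 1 f] lookup_single_times_eq_0[of "(a, 0)" "(0, 1)" 1 f]
    by (auto simp: mono2_def)
  have syzygy: "?y * p (Suc i, j) = ?x * p (i, Suc j)" if ij: "Suc (i + j) = m" for i j
  proof -
    \<comment> \<open>The leading monomials of the two multiples cancel, leaving in J a combination
      of the remainders alone.\<close>
    have "?x * mono2 (i, Suc j) = ?y * mono2 (Suc i, j)"
      by (simp add: mono2_def mult_single)
    then have "?y * p (Suc i, j) - ?x * p (i, Suc j)
        = ?x * (mono2 (i, Suc j) - p (i, Suc j)) - ?y * (mono2 (Suc i, j) - p (Suc i, j))"
      by (simp add: algebra_simps)
    also have "\<dots> \<in> J"
      by (rule module.subspace_diff[OF module_mult ideal];
          rule module.subspace_scale[OF module_mult ideal], rule p)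
    finally have "?y * p (Suc i, j) - ?x * p (i, Suc j) \<in> J" .
    \<comment> \<open>The remainders have degree at most m - 2, so multiplying them by a variable
      still stays below m. With a remainder of degree m - 1 this would fail.\<close>
    moreover have "Poly_Mapping.keys (?y * p (Suc i, j) - ?x * p (i, Suc j)) \<subseteq> monomials_below m"
    proof
      fix k assume k: "k \<in> Poly_Mapping.keys (?y * p (Suc i, j) - ?x * p (i, Suc j))"
      obtain a b where ab: "k = (a, b)" by fastforce
      from k have "Poly_Mapping.lookup (?y * p (Suc i, j)) (a, b) \<noteq> 0 \<or>
          Poly_Mapping.lookup (?x * p (i, Suc j)) (a, b) \<noteq> 0"
        by (auto simp: in_keys_iff lookup_minus ab)
      then have "a + b < m"
      proof
        assume "Poly_Mapping.lookup (?y * p (Suc i, j)) (a, b) \<noteq> 0"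
        then show ?thesis using p_small[of "Suc i" j a "b - 1"] ij by (cases b) (auto simp: ly ly0)
      next
        assume "Poly_Mapping.lookup (?x * p (i, Suc j)) (a, b) \<noteq> 0"
        then show ?thesis using p_small[of i "Suc j" "a - 1" b] ij by (cases a) (auto simp: lx lx0)
      qed
      then show "k \<in> monomials_below m" by (simp add: ab monomials_below_def)
    qed
    ultimately show ?thesis using low_degree_in_ideal_eq_0 by fastforce
  qed
  have div_x: "i \<le> a" if "Poly_Mapping.lookup (p (i, j)) (a, b) \<noteq> 0" "i + j = m" for i j a b
    using that
  proof (induction i arbitrary: j a b)
    case (Suc i)
    \<comment> \<open>The syzygy moves the coefficient at (a, b) to the one of
      \<open>p (i, Suc j)\<close> at (a - 1, b + 1); a = 0 is impossible, as x divides the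
      right-hand side.\<close>
    from Suc.prems have "Poly_Mapping.lookup (?x * p (i, Suc j)) (a, Suc b) \<noteq> 0"
      by (simp add: ly flip: syzygy)
    then show ?case using Suc.IH[of "Suc j" "a - 1" "Suc b"] Suc.prems by (cases a) (auto simp: lx lx0)
  qed simp
  have div_y: "j \<le> b" if "Poly_Mapping.lookup (p (i, j)) (a, b) \<noteq> 0" "i + j = m" for i j a b
    using that
  proof (induction j arbitrary: i a b)
    case (Suc j)
    from Suc.prems have "Poly_Mapping.lookup (?y * p (Suc i, j)) (Suc a, b) \<noteq> 0"
      by (simp add: lx syzygy)
    then show ?case using Suc.IH[of "Suc i" "Suc a" "b - 1"] Suc.prems by (cases b) (auto simp: ly ly0)
  qed simp
  have p_eq_0: "p (i, j) = 0" if "i + j = m" for i j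
  proof (rule poly_mapping_eqI)
    fix k :: "nat \<times> nat"
    obtain a b where "k = (a, b)" by fastforce
    \<comment> \<open>A nonzero coefficient would give a + b \<ge> i + j = m, against a + b + 1 <
      m.\<close>
    then show "Poly_Mapping.lookup (p (i, j)) k = Poly_Mapping.lookup 0 k"
      using div_x[of i j a b] div_y[of i j a b] p_small[of i j a b] that by fastforce
  qed
  have "mono2 (i, j) \<in> J" if "m \<le> i + j" for i j
  proof -
    \<comment> \<open>This picks a monomial of degree exactly m that divides x^i y^j.\<close>
    define i' where "i' = min i m"
    have "mono2 (i', m - i') \<in> J"
      using p(2)[of "(i', m - i')"] p_eq_0[of i' "m - i'"] by (simp add: i'_def)
    then have "mono2 (i - i', j - (m - i')) * mono2 (i', m - i') \<in> J"
      by (rule module.subspace_scale[OF module_mult ideal])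
    moreover have "i' \<le> i" "m - i' \<le> j" using that by (auto simp: i'_def min_def)
    ultimately show ?thesis by (simp add: mono2_def mult_single)
  qed
  then have "order_ge m \<subseteq> J"
    unfolding order_ge_eq_generated
    by (intro module.span_minimal[OF module_mult _ ideal]) (auto simp: monomials_below_def)
  then show ?thesis
    by (rule ideal_eqI[OF basis_mod_order_ge basis ideal, symmetric])
qed

end


section \<open>The staircase ideal is an isolated fixed point\<close>

text \<open>The square of the generator s is -1.\<close>

lemma uminus_mat_1_in_BT: "- mat 1 \<in> BT"
proof -
  have "BT_s \<otimes>\<^bsub>SL2\<^esub> BT_s \<in> BT"
    unfolding BT_def by (intro generate.eng generate.incl) simp_all
  moreover have "BT_s \<otimes>\<^bsub>SL2\<^esub> BT_s = - mat 1"
    by (simp add: SL2_def BT_s_def mat2_def vec_eq_iff forall_2 matrix_matrix_mult_def sum_2 mat_def)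
  ultimately show ?thesis by simp
qed

lemma det_BT: "A \<in> BT \<Longrightarrow> det A = 1"
  using group.generate_in_carrier[OF group_SL2 BT_generators_SL2] by (auto simp: BT_def SL2_def)

section \<open>Charts and separation of points\<close>

lemma openin_hilb_zariski_basic:
  "M \<subseteq> range mono2 \<Longrightarrow> \<phi> \<in> chart_functions M \<Longrightarrow>
    openin (hilb_zariski n) {I \<in> hilb_chart n M. \<phi> I \<noteq> 0}"
  unfolding hilb_zariski_def by (rule topology_generated_by_Basis) blast

lemma openin_hilb_chart: "M \<subseteq> range mono2 \<Longrightarrow> openin (hilb_zariski n) (hilb_chart n M)"
  using openin_hilb_zariski_basic[OF _ chart_functions.const[of 1]] by simp

lemma topspace_hilb_zariski:
  assumes "J \<in> topspace (hilb_zariski n)"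
  obtains M where "M \<subseteq> range mono2" "J \<in> hilb_chart n M"
  using assms unfolding hilb_zariski_def topology_generated_by_topspace by blast

text \<open>Either a chart around J misses (x,y)^m, or both ideals lie in it. In the second case
  some coordinate of a monomial of degree at least m is nonzero at J, while all of them vanish at
  (x,y)^m.\<close>

lemma separate_from_order_ge:
  assumes "J \<in> topspace (hilb_zariski n)" "J \<noteq> order_ge m"
  obtains U where "openin (hilb_zariski n) U" "J \<in> U" "order_ge m \<notin> U"
proof -
  obtain M where M: "M \<subseteq> range mono2" "J \<in> hilb_chart n M"
    using topspace_hilb_zariski[OF assms(1)] .
  then have J: "is_ideal J" "basis_mod J M"
    by (auto simp: hilb_chart_def hilb_def)
  show thesis
  proof (cases "basis_mod (order_ge m) M")
    case False
    then show thesis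
      using that[OF openin_hilb_chart[OF M(1)] M(2)] by (simp add: hilb_chart_def)
  next
    case True
    \<comment> \<open>Otherwise J contains (x,y)^m, and the common basis M forces equality.\<close>
    have "\<exists>e. e \<notin> monomials_below m \<and> mono2 e \<notin> J"
    proof (rule ccontr)
      assume "\<not> ?thesis"
      then have "order_ge m \<subseteq> J"
        unfolding order_ge_eq_generated
        by (intro module.span_minimal[OF module_mult _ J(1)]) auto
      then show False
        using ideal_eqI[OF True J(2,1)] assms(2) by blast
    qed
    then obtain e where e: "e \<notin> monomials_below m" "mono2 e \<notin> J" by blast
    obtain b where b: "coeff_mod J M (mono2 e) b \<noteq> 0"
      using e(2) basis_mod_coeff_mod(2)[OF J(2), of "mono2 e"] by (force simp: const2_0)
    then have "b \<in> M"
      using basis_mod_coeff_mod(1)[OF J(2)] by blast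
    have "mono2 e \<in> order_ge m"
      using e(1) by (auto simp: order_ge_def mono2_def monomials_below_def)
    then have "coeff_mod (order_ge m) M (mono2 e) = (\<lambda>_. 0)"
      by (intro basis_mod_eq[OF True]) (simp_all add: const2_0)
    then show thesis
      using that[OF openin_hilb_zariski_basic[OF M(1) chart_functions.coord[OF \<open>b \<in> M\<close>, of e], of n]]
        M(2) b by simp
  qed
qed

text \<open>The point and its complement are both closed, so an irreducible set through the point
  cannot leave it.\<close>

lemma singleton_component:
  assumes "openin X {x}" "closedin X {x}"
  shows "irreducible_component X C \<and> x \<in> C \<longleftrightarrow> C = {x}"
proof -
  have x: "irreduciblein X {x}"
    using closedin_subset[OF assms(2)] by (auto simp: irreduciblein_def)
  have sub: "D = {x}" if D: "irreduciblein X D" "x \<in> D" for D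
  proof -
    have "closedin X (topspace X - {x})"
      using assms(1) by blast
    moreover have "D \<subseteq> {x} \<union> (topspace X - {x})"
      using D(1) by (auto simp: irreduciblein_def)
    ultimately have "D \<subseteq> {x} \<or> D \<subseteq> topspace X - {x}"
      using D(1) assms(2) unfolding irreduciblein_def by blast
    then show ?thesis using D(2) by blast
  qed
  show ?thesis
    using x sub unfolding irreducible_component_def by blast
qed

text \<open>Irreducible sets are nonempty, so at most one exists here and no strict inclusion in a
  chain is possible.\<close>

lemma krull_dim_eq_0:
  assumes "topspace X \<subseteq> {x}"
  shows "krull_dim X = 0"
proof -
  have "n = 0" if Z: "\<forall>i\<le>n. closedin X (Z i) \<and> irreduciblein X (Z i)" "\<forall>i<n. Z i \<subset> Z (Suc i)"
    for n :: nat and Z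
  proof (rule ccontr)
    assume "n \<noteq> 0"
    then have "Z 0 \<subset> Z 1" "irreduciblein X (Z 0)" "irreduciblein X (Z 1)"
      using Z by auto
    moreover have "S = {x}" if "irreduciblein X S" for S
      using that assms by (auto simp: irreduciblein_def)
    ultimately show False by blast
  qed
  then have "krull_dim X \<le> 0"
    unfolding krull_dim_def zero_enat_def by (intro Sup_least) blast
  then show ?thesis by simp
qed

theorem theorem6p8:
  fixes m :: nat
  defines "X \<equiv> hilb_fixed (m * (m + 1) div 2) BT"
  shows "(\<exists>!C. irreducible_component X C \<and> partition_ideal (staircase m) \<in> C) \<and>
         (\<forall>C. irreducible_component X C \<and> partition_ideal (staircase m) \<in> C
              \<longrightarrow> krull_dim (subtopology X C) = 0)"
proof -
  let ?n = "m * (m + 1) div 2" and ?M = "mono2 ` monomials_below m"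
  let ?F = "{I \<in> hilb ?n. \<forall>A\<in>BT. ideal_act A I = I}"
  have F: "order_ge m \<in> ?F"
    using order_ge_in_hilb[of m] by (simp add: ideal_act_order_ge det_BT)
  \<comment> \<open>The chart supplies the basis and -1 in the group the invariance, which together
    leave only (x,y)^m.\<close>
  have isolated: "hilb_chart ?n ?M \<inter> ?F = {order_ge m}"
  proof
    show "{order_ge m} \<subseteq> hilb_chart ?n ?M \<inter> ?F"
      using F by (auto simp: hilb_chart_def basis_mod_order_ge)
    show "hilb_chart ?n ?M \<inter> ?F \<subseteq> {order_ge m}"
      using antipode_invariant_ideal_eq uminus_mat_1_in_BT by (auto simp: hilb_chart_def hilb_def)
  qed
  have "openin (hilb_zariski ?n) (hilb_chart ?n ?M)"
    by (rule openin_hilb_chart) blast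
  then have op: "openin X {order_ge m}"
    unfolding X_def hilb_fixed_def isolated[symmetric] by (rule openin_subtopology_Int)
  \<comment> \<open>Closedness is checked pointwise: every other fixed point has a neighbourhood
    avoiding (x,y)^m.\<close>
  have "openin X (topspace X - {order_ge m})"
  proof (rule openin_subopen[THEN iffD2], rule ballI)
    fix J assume J: "J \<in> topspace X - {order_ge m}"
    then have "J \<in> topspace (hilb_zariski ?n)" "J \<noteq> order_ge m"
      by (auto simp: X_def hilb_fixed_def)
    then obtain U where U: "openin (hilb_zariski ?n) U" "J \<in> U" "order_ge m \<notin> U"
      by (rule separate_from_order_ge)
    then have "openin X (U \<inter> ?F)"
      unfolding X_def hilb_fixed_def by (intro openin_subtopology_Int)
    moreover have "U \<inter> ?F \<subseteq> topspace X - {order_ge m}"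
      using openin_subset[OF calculation] U(3) by blast
    moreover have "J \<in> U \<inter> ?F"
      using J U(2) by (auto simp: X_def hilb_fixed_def)
    ultimately show "\<exists>T. openin X T \<and> J \<in> T \<and> T \<subseteq> topspace X - {order_ge m}"
      by blast
  qed
  then have "closedin X {order_ge m}"
    using openin_subset[OF op] by (simp add: closedin_def)
  then have "irreducible_component X C \<and> order_ge m \<in> C \<longleftrightarrow> C = {order_ge m}" for C
    by (rule singleton_component[OF op])
  then show ?thesis
    by (simp add: partition_ideal_staircase krull_dim_eq_0[of _ "order_ge m"])
qed

end
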